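(* $$\Pi(4,6)=\frac{5}{3}.$$
   Context: For a finite-dimensional real Banach space $E$, fix a linear isometric embedding $E\subset \ell_\infty(\mathbb{N})$; the linear projection constant of $E$ is $\Pi(E):=\inf\{\|P\| : P\colon \ell_\infty(\mathbb{N})\to E \text{ bounded surjective linear map with } P^2=P\}$ (independent of the embedding). For integers $0\le n\leq d$ set $\Pi(n,d):=\sup\{\Pi(E) : E\subset \ell_\infty^d \text{ is an } n\text{-dimensional linear subspace}\}$, where $\ell_\infty^d$ is $\mathbb{R}^d$ with the maximum norm and $E$ carries the induced norm. *)

theory Defs
  imports "HOL-Analysis.Analysis"
begin

text \<open>
  As \<^typ>\<open>nat\<close> is discrete, the bounded continuous functions on it are exactly the bounded
  real sequences, and the norm of \<^typ>\<open>nat \<Rightarrow>\<^sub>C real\<close> is the supremum norm.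
\<close>

type_synonym linf = "nat \<Rightarrow>\<^sub>C real"

text \<open>
  A finite-dimensional normed space is represented as a subspace \<open>E\<close> of an arbitrary ambient
  normed space. An embedding of \<open>E\<close> is taken to be defined and linear on the ambient space, but
  isometric only on \<open>E\<close>; since every linear map on \<open>E\<close> extends linearly, the restrictions to \<open>E\<close>
  are all the linear isometric embeddings of \<open>E\<close>.
\<close>

definition isometric_embedding :: "'a::real_normed_vector set \<Rightarrow> ('a \<Rightarrow> linf) \<Rightarrow> bool" where
  "isometric_embedding E J \<longleftrightarrow> linear J \<and> (\<forall>x\<in>E. norm (J x) = norm x)"

definition fixed_embedding :: "'a::real_normed_vector set \<Rightarrow> 'a \<Rightarrow> linf" where
  "fixed_embedding E = (SOME J. isometric_embedding E J)"

text \<open>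
  Projections are bounded operators on \<^typ>\<open>linf\<close> whose range is the given subspace; as that
  subspace carries the induced norm, restricting the codomain does not change the operator norm.
\<close>

definition projections_onto :: "linf set \<Rightarrow> (linf \<Rightarrow>\<^sub>L linf) set" where
  "projections_onto F = {P. range (blinfun_apply P) = F \<and> P o\<^sub>L P = P}"

text \<open>
  Finite-dimensional subspaces of \<^typ>\<open>linf\<close> are complemented, so the infimum below is over a
  nonempty set of nonnegative reals whenever \<open>E\<close> is finite-dimensional and embeds in \<^typ>\<open>linf\<close>.
\<close>

definition proj_const :: "'a::real_normed_vector set \<Rightarrow> real" where
  "proj_const E = Inf (norm ` projections_onto (fixed_embedding E ` E))"

text \<open>
  \<open>\<real>\<^sup>d\<close> with the maximum norm, its vectors being padded with zeros to infinite sequences; this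
  allows \<open>d\<close> to be a natural number (possibly 0) instead of a type. The three lemmas show that it
  is a linear space whose vectors are the arbitrary choices of the first \<open>d\<close> coordinates and
  whose norm is the maximum norm.
\<close>

definition linf_fin :: "nat \<Rightarrow> linf set" where
  "linf_fin d = {x. \<forall>i\<ge>d. apply_bcontfun x i = 0}"

lemma subspace_linf_fin: "subspace (linf_fin d)"
  by (simp add: subspace_def linf_fin_def)

lemma linf_fin_coordinates: "\<exists>!x\<in>linf_fin d. \<forall>i<d. apply_bcontfun x i = a i"
proof -
  define f where "f i = (if i < d then a i else 0)" for i
  have "range f \<subseteq> insert 0 (a ` {..<d})"
    by (auto simp: f_def)
  then have "bounded (range f)"
    using finite_imp_bounded finite_subset by blast
  then have "f \<in> bcontfun"
    by (simp add: bcontfun_def)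
  then obtain g where g: "f = apply_bcontfun g"
    by (rule bcontfunE)
  show ?thesis
  proof (rule ex1I[of _ g])
    show "g \<in> linf_fin d \<and> (\<forall>i<d. apply_bcontfun g i = a i)"
      by (simp add: linf_fin_def g[symmetric] f_def)
  next
    fix x assume x: "x \<in> linf_fin d \<and> (\<forall>i<d. apply_bcontfun x i = a i)"
    show "x = g"
      by (rule bcontfun_eqI) (use x in \<open>auto simp: linf_fin_def g[symmetric] f_def\<close>)
  qed
qed

lemma norm_linf_fin:
  assumes "x \<in> linf_fin d" and "d > 0"
  shows "norm x = Max ((\<lambda>i. \<bar>apply_bcontfun x i\<bar>) ` {..<d})"
proof (rule antisym)
  let ?M = "Max ((\<lambda>i. \<bar>apply_bcontfun x i\<bar>) ` {..<d})"
  have le: "\<bar>apply_bcontfun x i\<bar> \<le> ?M" if "i < d" for i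
    using that by (intro Max_ge) auto
  have "0 \<le> ?M"
    using le[OF assms(2)] by (meson abs_ge_zero order_trans)
  show "norm x \<le> ?M"
  proof (rule norm_bound)
    fix i
    show "norm (apply_bcontfun x i) \<le> ?M"
      using assms(1) le[of i] \<open>0 \<le> ?M\<close> by (cases "i < d") (auto simp: linf_fin_def)
  qed
  show "?M \<le> norm x"
    using assms(2) norm_bounded[of x] by (subst Max_le_iff) auto
qed

text \<open>
  For \<open>n \<le> d\<close> the supremum is over a nonempty set; it is bounded since an \<open>n\<close>-dimensional
  space has projection constant at most \<open>n\<close>.
\<close>

definition max_proj_const :: "nat \<Rightarrow> nat \<Rightarrow> real" where
  "max_proj_const n d = Sup (proj_const ` {E. subspace E \<and> E \<subseteq> linf_fin d \<and> dim E = n})"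

end

theory Submission
  imports Defs
begin

text \<open>
  Upper bound. For a fixed subspace \<open>E\<close> of \<open>\<real>\<^sup>d\<close> with the maximum norm, the norm of a projection is
  the largest absolute row sum of its matrix, so by the minimax principle (a separating hyperplane
  in the space of vectors of row sums) it suffices to find, for each positive probability
  weight \<open>\<nu>\<close> on the coordinates, a projection onto \<open>E\<close> whose \<open>\<nu>\<close>-average of row sums is small
  (\<open>small_projection\<close>). The right choice is the projection that is orthogonal for the inner product
  weighted by \<open>\<nu>\<close>. With \<open>x\<^sub>i = sqrt \<nu>\<^sub>i\<close> its average row sum is \<open>\<Sum> x\<^sub>i x\<^sub>j \<bar>U\<^sub>i\<^sub>j\<bar>\<close>, where \<open>U\<close> is an
  orthogonal projection matrix of rank \<open>d - 2\<close>.

  Now \<open>1 - U\<close> has rank two, so it is the Gram matrix of planar vectors \<open>v\<^sub>i = r\<^sub>i (cos \<theta>\<^sub>i, sin \<theta>\<^sub>i)\<close>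
  with \<open>\<Sum> v\<^sub>i v\<^sub>i\<^sup>T = 1\<close>, and with \<open>z\<^sub>i = x\<^sub>i r\<^sub>i\<close> the quantity to be bounded is
  \<open>1 + \<Sum> z\<^sub>i z\<^sub>j \<bar>cos (\<theta>\<^sub>i - \<theta>\<^sub>j)\<bar> - 2 \<Sum> z\<^sub>i\<^sup>2\<close>. The expected extremal configuration consists of
  three lines at mutual angles of 60 degrees, each carrying two of the six vectors. The absolute
  value is therefore replaced by the trigonometric polynomial of \<open>abs_cos_le\<close>, which is exact at the
  angles 0 and 60 degrees. What remains only involves the moments of the double angles, and the
  loss caused by a nonzero moment \<open>\<Sum> z\<^sub>i e\<^sup>2\<^sup>i\<^sup>\<theta>\<close> is compensated by a sharpened Cauchy-Schwarz
  estimate of \<open>\<Sum> z\<^sub>i\<close>, in which the vectors \<open>v\<^sub>i\<close> are stretched in the direction of that moment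
  (\<open>planar_bound_aligned\<close>). For \<open>d \<ge> 6\<close> the result is the bound \<open>7/3 - 4/d\<close>, which is \<open>5/3\<close> for
  \<open>d = 6\<close>.

  Lower bound. The extremal configuration belongs to the space of all \<open>y\<close> with
  \<open>y\<^sub>0 + y\<^sub>1 = y\<^sub>2 + y\<^sub>3 = y\<^sub>4 + y\<^sub>5\<close>. Trace duality against a symmetric sign matrix that leaves this
  space invariant shows that no projection onto it has norm below \<open>5/3\<close>
  (\<open>equal_pairs_lower_bound\<close>).

  Both estimates concern projections onto \<open>E\<close> itself. They carry over to an arbitrary
  isometric copy of \<open>E\<close> because bounded sequences form an injective space: contractions into it
  extend by the Hahn-Banach theorem, applied to each coordinate
  (\<open>projection_transfer_to\<close>, \<open>projection_transfer_from\<close>).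
\<close>

section \<open>An inequality for planar vectors\<close>

text \<open>
  The polynomial is the quartic in \<open>u = \<bar>cos t\<bar>\<close> without odd powers that agrees with \<open>u\<close> at \<open>u = 1\<close> and
  touches it at \<open>u = 1/2\<close>. The difference is a multiple of \<open>(u - 1/2)\<^sup>2 (1 - u) (u + 2)\<close>; the
  fourth root \<open>- 2\<close> is forced by the absence of the cubic term.
\<close>

lemma abs_cos_le:
  fixes t :: real
  shows "\<bar>cos t\<bar> \<le> 2/3 + 7/18 * cos (2*t) - 1/18 * cos (4*t)"
proof -
  define u where "u = \<bar>cos t\<bar>"
  have u: "0 \<le> u" "u \<le> 1" "(cos t)\<^sup>2 = u\<^sup>2" by (auto simp: u_def)
  have c2: "cos (2*t) = 2 * u\<^sup>2 - 1"
    by (simp add: cos_double_cos u(3))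
  have c4: "cos (4*t) = 2 * (2 * u\<^sup>2 - 1)\<^sup>2 - 1"
    using cos_double_cos[of "2*t"] c2 by simp
  have "0 \<le> (u - 1/2)\<^sup>2 * ((1 - u) * (u + 2))"
    using u by simp
  also have "\<dots> = 9/4 * (2/3 + 7/18 * cos (2*t) - 1/18 * cos (4*t) - u)"
    unfolding c2 c4 by (simp add: power2_eq_square field_simps)
  finally show ?thesis by (simp add: u_def)
qed

text \<open>
  The expression is affine in \<open>m\<close>, with value \<open>q\<^sup>2\<close> at \<open>m = q\<close> and \<open>(1 - 2 q)\<^sup>2\<close> at \<open>m = 1\<close>.
\<close>

lemma quadratic_nonneg:
  fixes q m :: real
  assumes "0 \<le> q" "q \<le> m" "m \<le> 1"
  shows "0 \<le> 4 * q\<^sup>2 - q - 3 * m * q + m"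
proof (cases "3 * q \<le> 1")
  case True
  have "0 \<le> (m - q) * (1 - 3 * q) + q\<^sup>2" using True assms by simp
  then show ?thesis by (simp add: power2_eq_square algebra_simps)
next
  case False
  have "0 \<le> (1 - m) * (3 * q - 1) + (1 - 2 * q)\<^sup>2" using False assms by simp
  then show ?thesis by (simp add: power2_eq_square algebra_simps)
qed

text \<open>
  For a unit vector with double angle \<open>\<phi>\<close> and \<open>c = cos \<phi>\<close>, the right-hand side is the squared length
  of its image under \<open>diag (1 + \<rho>, 1 - \<rho>)\<close>. The linear function \<open>1 + \<rho> c\<close> is the chord of this
  length between \<open>c = -1\<close> and \<open>c = 1\<close>, and the quadratic term is a lower bound for the gap
  between the concave length and its chord.
\<close>

lemma stretch_le:
  fixes \<rho> c :: real
  assumes "0 \<le> \<rho>" "\<rho> \<le> 1" "\<bar>c\<bar> \<le> 1"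
  shows "(1 + \<rho> * c + \<rho>\<^sup>2 / 4 * (1 - c\<^sup>2))\<^sup>2 \<le> 1 + \<rho>\<^sup>2 + 2 * \<rho> * c"
proof -
  have c: "-1 \<le> c" "c \<le> 1" using assms(3) by auto
  define e where "e = \<rho>\<^sup>2 / 4 * (1 - c\<^sup>2)"
  have "0 \<le> e" unfolding e_def using assms(3) by (simp add: abs_square_le_1)
  have "e = \<rho> * (1 - c) * (\<rho> * (1 + c) / 4)"
    by (simp add: e_def power2_eq_square algebra_simps)
  also have "\<dots> \<le> \<rho> * (1 - c) * 2"
  proof (rule mult_left_mono)
    have "\<rho> * (1 + c) \<le> 1 * 2" by (intro mult_mono) (use assms c in auto)
    then show "\<rho> * (1 + c) / 4 \<le> 2" by simp
  qed (use assms c in simp)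
  also have "\<dots> \<le> 2 - 2 * \<rho> * c" using assms by (simp add: algebra_simps)
  finally have "0 \<le> e * (2 - 2 * \<rho> * c - e)" using \<open>0 \<le> e\<close> by simp
  also have "\<dots> = 1 + \<rho>\<^sup>2 + 2 * \<rho> * c - (1 + \<rho> * c + e)\<^sup>2"
    by (simp add: e_def power2_eq_square field_simps)
  finally show ?thesis by (simp add: e_def)
qed

lemma sum_sum_cos_diff:
  fixes z \<phi> :: "'i \<Rightarrow> real"
  shows "(\<Sum>i\<in>I. \<Sum>j\<in>I. z i * z j * cos (\<phi> i - \<phi> j))
    = (\<Sum>i\<in>I. z i * cos (\<phi> i))\<^sup>2 + (\<Sum>i\<in>I. z i * sin (\<phi> i))\<^sup>2"
  by (simp add: power2_eq_square sum_product cos_diff distrib_left sum.distrib mult_ac)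

text \<open>
  The alignment hypotheses say that the moment \<open>\<Sum> z\<^sub>i e\<^sup>2\<^sup>i\<^sup>\<theta>\<close>, with \<open>z\<^sub>i = x\<^sub>i r\<^sub>i\<close>, is a nonnegative
  real number \<open>\<rho> Z\<close>, where \<open>Z = \<Sum> z\<^sub>i\<close>. The moment \<open>\<Sum> z\<^sub>i e\<^sup>4\<^sup>i\<^sup>\<theta>\<close> has absolute value at least \<open>\<bar>1 - 2 q\<bar> Z\<close>,
  where \<open>(1 - q) Z = \<Sum> z\<^sub>i (cos 2\<theta>\<^sub>i)\<^sup>2\<close>. If \<open>\<rho> = 0\<close>, the bound follows from \<open>Z\<^sup>2 \<le> 2\<close>
  and \<open>\<Sum> z\<^sub>i\<^sup>2 \<ge> Z\<^sup>2 / card I\<close>. If \<open>\<rho>\<close> is positive, the polynomial bound gets worse, but the first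
  moment of \<open>r\<^sub>i\<^sup>2\<close> vanishes, so \<open>x\<close> and \<open>r\<close> cannot be proportional and \<open>Z\<^sup>2\<close> falls short of 2. The
  stretched Cauchy-Schwarz estimate quantifies this, and \<open>quadratic_nonneg\<close> says that
  the gain outweighs the loss, in the worst case \<open>card I = 6\<close>.
\<close>

lemma planar_bound_aligned:
  fixes x r \<theta> :: "'i \<Rightarrow> real"
  assumes N: "6 \<le> card I"
    and nonneg: "\<And>i. 0 \<le> x i" "\<And>i. 0 \<le> r i"
    and x: "(\<Sum>i\<in>I. (x i)\<^sup>2) = 1" and r: "(\<Sum>i\<in>I. (r i)\<^sup>2) = 2"
    and iso: "(\<Sum>i\<in>I. (r i)\<^sup>2 * cos (2 * \<theta> i)) = 0"
    and al_sin: "(\<Sum>i\<in>I. x i * r i * sin (2 * \<theta> i)) = 0"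
    and al_cos: "0 \<le> (\<Sum>i\<in>I. x i * r i * cos (2 * \<theta> i))"
  shows "(\<Sum>i\<in>I. \<Sum>j\<in>I. (x i * r i) * (x j * r j) * \<bar>cos (\<theta> i - \<theta> j)\<bar>)
          - 2 * (\<Sum>i\<in>I. (x i * r i)\<^sup>2) \<le> 4/3 - 4 / card I"
proof -
  define z where "z i = x i * r i" for i
  define c where "c i = cos (2 * \<theta> i)" for i
  define Z where "Z = sum z I"
  define C where "C = (\<Sum>i\<in>I. z i * c i)"
  define S where "S = (\<Sum>i\<in>I. z i * (c i)\<^sup>2)"
  define N where "N = real (card I)"
  have N6: "6 \<le> N" using N by (simp add: N_def)
  have z0: "0 \<le> z i" for i using nonneg by (simp add: z_def)
  have c1: "\<bar>c i\<bar> \<le> 1" for i by (simp add: c_def)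
  have Z0: "0 \<le> Z" unfolding Z_def by (intro sum_nonneg z0)
  have C0: "0 \<le> C" using al_cos by (simp add: C_def z_def c_def)
  have "C \<le> Z"
    unfolding C_def Z_def
    by (intro sum_mono mult_left_le z0 abs_le_D1[OF c1])
  have "S \<le> Z"
    unfolding S_def Z_def
    by (intro sum_mono mult_left_le z0) (simp add: abs_square_le_1 c1)
  have CS: "C\<^sup>2 \<le> Z * S"
  proof -
    have "C\<^sup>2 = (\<Sum>i\<in>I. sqrt (z i) * (sqrt (z i) * c i))\<^sup>2"
      unfolding C_def using z0 by (simp flip: mult.assoc)
    also have "\<dots> \<le> (\<Sum>i\<in>I. (sqrt (z i))\<^sup>2) * (\<Sum>i\<in>I. (sqrt (z i) * c i)\<^sup>2)"
      by (rule Cauchy_Schwarz_ineq_sum)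
    also have "\<dots> = Z * S"
      unfolding Z_def S_def using z0 by (simp add: power_mult_distrib)
    finally show ?thesis .
  qed
  have zz: "Z\<^sup>2 / N \<le> (\<Sum>i\<in>I. (z i)\<^sup>2)"
  proof -
    have "(\<Sum>i\<in>I. 1 * z i)\<^sup>2 \<le> (\<Sum>i\<in>I. 1\<^sup>2) * (\<Sum>i\<in>I. (z i)\<^sup>2)"
      by (rule Cauchy_Schwarz_ineq_sum)
    then show ?thesis using N6 by (simp add: Z_def N_def field_simps)
  qed
  have cos4: "(\<Sum>i\<in>I. z i * cos (4 * \<theta> i)) = 2 * S - Z"
  proof -
    have "cos (4 * \<theta> i) = 2 * (c i)\<^sup>2 - 1" for i
      using cos_double_cos[of "2 * \<theta> i"] by (simp add: c_def)
    then have "z i * cos (4 * \<theta> i) = 2 * (z i * (c i)\<^sup>2) - z i" for i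
      unfolding \<open>\<And>i. cos (4 * \<theta> i) = 2 * (c i)\<^sup>2 - 1\<close> by (simp add: right_diff_distrib)
    then show ?thesis
      by (simp only: S_def Z_def sum_subtractf flip: sum_distrib_left)
  qed
  have main: "(\<Sum>i\<in>I. \<Sum>j\<in>I. z i * z j * \<bar>cos (\<theta> i - \<theta> j)\<bar>)
    \<le> 2/3 * Z\<^sup>2 + 7/18 * C\<^sup>2 - 1/18 * (2 * S - Z)\<^sup>2"
  proof -
    have "(\<Sum>i\<in>I. \<Sum>j\<in>I. z i * z j * \<bar>cos (\<theta> i - \<theta> j)\<bar>)
      \<le> (\<Sum>i\<in>I. \<Sum>j\<in>I. z i * z j * (2/3 + 7/18 * cos (2 * \<theta> i - 2 * \<theta> j)
            - 1/18 * cos (4 * \<theta> i - 4 * \<theta> j)))"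
    proof (intro sum_mono mult_left_mono)
      fix i j
      show "\<bar>cos (\<theta> i - \<theta> j)\<bar> \<le> 2/3 + 7/18 * cos (2 * \<theta> i - 2 * \<theta> j)
            - 1/18 * cos (4 * \<theta> i - 4 * \<theta> j)"
        using abs_cos_le[of "\<theta> i - \<theta> j"] by (simp add: right_diff_distrib)
    qed (use z0 in simp)
    also have "\<dots> = 2/3 * (\<Sum>i\<in>I. \<Sum>j\<in>I. z i * z j)
       + 7/18 * (\<Sum>i\<in>I. \<Sum>j\<in>I. z i * z j * cos (2 * \<theta> i - 2 * \<theta> j))
       - 1/18 * (\<Sum>i\<in>I. \<Sum>j\<in>I. z i * z j * cos (4 * \<theta> i - 4 * \<theta> j))"
      by (simp add: sum_distrib_left sum.distrib sum_subtractf algebra_simps)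
    also have "(\<Sum>i\<in>I. \<Sum>j\<in>I. z i * z j) = Z\<^sup>2"
      by (simp add: Z_def power2_eq_square sum_product)
    also have "(\<Sum>i\<in>I. \<Sum>j\<in>I. z i * z j * cos (2 * \<theta> i - 2 * \<theta> j)) = C\<^sup>2"
      using al_sin by (simp add: sum_sum_cos_diff C_def c_def z_def)
    also have "(\<Sum>i\<in>I. \<Sum>j\<in>I. z i * z j * cos (4 * \<theta> i - 4 * \<theta> j))
       = (2 * S - Z)\<^sup>2 + (\<Sum>i\<in>I. z i * sin (4 * \<theta> i))\<^sup>2"
      by (simp add: sum_sum_cos_diff cos4)
    finally show ?thesis using zero_le_power2[of "\<Sum>i\<in>I. z i * sin (4 * \<theta> i)"] by argo
  qed
  show ?thesis
  proof (cases "Z = 0")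
    case True
    have "C = 0" using CS True by simp
    have "(\<Sum>i\<in>I. \<Sum>j\<in>I. z i * z j * \<bar>cos (\<theta> i - \<theta> j)\<bar>) \<le> 0"
      by (rule order_trans[OF main]) (simp add: True \<open>C = 0\<close>)
    moreover have "0 \<le> (\<Sum>i\<in>I. (z i)\<^sup>2)" by (simp add: sum_nonneg)
    moreover have "4 / N \<le> 4 / 3" using N6 by (simp add: field_simps)
    ultimately show ?thesis by (simp add: z_def N_def)
  next
    case False
    then have Zpos: "0 < Z" using Z0 by simp
    define \<rho> where "\<rho> = C / Z"
    define q where "q = 1 - S / Z"
    have \<rho>: "0 \<le> \<rho>" "\<rho> \<le> 1" using Zpos C0 \<open>C \<le> Z\<close> by (auto simp: \<rho>_def)
    have CZ: "C = \<rho> * Z" and SZ: "S = (1 - q) * Z" using Zpos by (auto simp: \<rho>_def q_def)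
    have q0: "0 \<le> q" using Zpos \<open>S \<le> Z\<close> by (simp add: q_def)
    have "\<rho>\<^sup>2 * Z\<^sup>2 \<le> (1 - q) * Z\<^sup>2"
      using CS unfolding CZ SZ by (simp add: power2_eq_square mult_ac)
    then have qm: "q \<le> 1 - \<rho>\<^sup>2" using Zpos by simp
    have \<rho>2: "\<rho>\<^sup>2 \<le> 1" using \<rho> by (simp add: abs_square_le_1)
    define h where "h i = 1 + \<rho> * c i + \<rho>\<^sup>2 / 4 * (1 - (c i)\<^sup>2)" for i
    have "(\<Sum>i\<in>I. z i * h i) = Z + \<rho> * C + \<rho>\<^sup>2 / 4 * (Z - S)"
    proof -
      have "z i * h i = z i + \<rho> * (z i * c i) + \<rho>\<^sup>2 / 4 * (z i - z i * (c i)\<^sup>2)" for i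
        by (simp add: h_def field_simps)
      then show ?thesis
        by (simp only: Z_def C_def S_def sum.distrib sum_subtractf flip: sum_distrib_left)
    qed
    also have "\<dots> = Z * (1 + \<rho>\<^sup>2 + \<rho>\<^sup>2 * q / 4)"
      unfolding CZ SZ by (simp add: power2_eq_square algebra_simps)
    finally have sum_zh: "(\<Sum>i\<in>I. z i * h i) = Z * (1 + \<rho>\<^sup>2 + \<rho>\<^sup>2 * q / 4)" .
    have "(\<Sum>i\<in>I. z i * h i)\<^sup>2 = (\<Sum>i\<in>I. x i * (r i * h i))\<^sup>2"
      by (simp add: z_def mult_ac)
    also have "\<dots> \<le> (\<Sum>i\<in>I. (x i)\<^sup>2) * (\<Sum>i\<in>I. (r i * h i)\<^sup>2)"
      by (rule Cauchy_Schwarz_ineq_sum)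
    also have "\<dots> = (\<Sum>i\<in>I. (r i)\<^sup>2 * (h i)\<^sup>2)"
      by (simp add: x power_mult_distrib)
    also have "\<dots> \<le> (\<Sum>i\<in>I. (r i)\<^sup>2 * (1 + \<rho>\<^sup>2 + 2 * \<rho> * c i))"
      by (intro sum_mono mult_left_mono) (use stretch_le[OF \<rho> c1] in \<open>auto simp: h_def\<close>)
    also have "\<dots> = (1 + \<rho>\<^sup>2) * (\<Sum>i\<in>I. (r i)\<^sup>2) + 2 * \<rho> * (\<Sum>i\<in>I. (r i)\<^sup>2 * c i)"
      by (simp add: sum.distrib sum_distrib_left algebra_simps)
    also have "\<dots> = 2 * (1 + \<rho>\<^sup>2)" using r iso by (simp add: c_def)
    finally have "Z\<^sup>2 * (1 + \<rho>\<^sup>2 + \<rho>\<^sup>2 * q / 4)\<^sup>2 \<le> 2 * (1 + \<rho>\<^sup>2)"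
      unfolding sum_zh by (simp add: power_mult_distrib)
    moreover have "(1 + \<rho>\<^sup>2) * (1 + \<rho>\<^sup>2 + \<rho>\<^sup>2 * q / 2) \<le> (1 + \<rho>\<^sup>2 + \<rho>\<^sup>2 * q / 4)\<^sup>2"
      using zero_le_power2[of "\<rho>\<^sup>2 * q / 4"] by (simp add: power2_eq_square algebra_simps)
    ultimately have "(1 + \<rho>\<^sup>2) * (Z\<^sup>2 * (1 + \<rho>\<^sup>2 + \<rho>\<^sup>2 * q / 2)) \<le> (1 + \<rho>\<^sup>2) * 2"
      by (smt (verit) mult.assoc mult.commute mult_left_mono zero_le_power2)
    then have Z_le: "Z\<^sup>2 * (1 + \<rho>\<^sup>2 + \<rho>\<^sup>2 * q / 2) \<le> 2"
      by (rule mult_left_le_imp_le) (simp add: add_pos_nonneg)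
    \<comment> \<open>The target is \<open>2 k\<close>; \<open>6 \<le> card I\<close> enters through \<open>1/3 \<le> k\<close>.\<close>
    define k where "k = 2/3 - 2/N"
    have k: "1/3 \<le> k" using N6 by (simp add: k_def field_simps)
    have key: "k + 7/18 * \<rho>\<^sup>2 - 1/18 * (1 - 2 * q)\<^sup>2 \<le> k * (1 + \<rho>\<^sup>2 + \<rho>\<^sup>2 * q / 2)"
    proof -
      have "0 \<le> 4 * q\<^sup>2 - q - 3 * (1 - \<rho>\<^sup>2) * q + (1 - \<rho>\<^sup>2)"
        using quadratic_nonneg[OF q0 qm] by simp
      then have "7/18 * \<rho>\<^sup>2 - 1/18 * (1 - 2 * q)\<^sup>2 \<le> 1/3 * (\<rho>\<^sup>2 + \<rho>\<^sup>2 * q / 2)"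
        by (simp add: power2_eq_square field_simps)
      also have "\<dots> \<le> k * (\<rho>\<^sup>2 + \<rho>\<^sup>2 * q / 2)"
        using k q0 by (intro mult_right_mono) auto
      finally show ?thesis by (simp add: algebra_simps)
    qed
    have "(\<Sum>i\<in>I. \<Sum>j\<in>I. z i * z j * \<bar>cos (\<theta> i - \<theta> j)\<bar>) - 2 * (\<Sum>i\<in>I. (z i)\<^sup>2)
      \<le> 2/3 * Z\<^sup>2 + 7/18 * C\<^sup>2 - 1/18 * (2 * S - Z)\<^sup>2 - 2 * (Z\<^sup>2 / N)"
      using main zz by linarith
    also have "\<dots> = Z\<^sup>2 * (k + 7/18 * \<rho>\<^sup>2 - 1/18 * (1 - 2 * q)\<^sup>2)"
      unfolding CZ SZ k_def by (simp add: power2_eq_square algebra_simps)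
    also have "\<dots> \<le> Z\<^sup>2 * (k * (1 + \<rho>\<^sup>2 + \<rho>\<^sup>2 * q / 2))"
      by (intro mult_left_mono key) simp
    also have "\<dots> = k * (Z\<^sup>2 * (1 + \<rho>\<^sup>2 + \<rho>\<^sup>2 * q / 2))" by simp
    also have "\<dots> \<le> k * 2" by (intro mult_left_mono Z_le) (use k in simp)
    also have "\<dots> = 4/3 - 4/N" by (simp add: k_def)
    finally show ?thesis by (simp add: z_def N_def)
  qed
qed

lemma planar_bound:
  fixes x r \<theta> :: "'i \<Rightarrow> real"
  assumes N: "6 \<le> card I"
    and nonneg: "\<And>i. 0 \<le> x i" "\<And>i. 0 \<le> r i"
    and x: "(\<Sum>i\<in>I. (x i)\<^sup>2) = 1" and r: "(\<Sum>i\<in>I. (r i)\<^sup>2) = 2"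
    and iso: "(\<Sum>i\<in>I. (r i)\<^sup>2 * cos (2 * \<theta> i)) = 0" "(\<Sum>i\<in>I. (r i)\<^sup>2 * sin (2 * \<theta> i)) = 0"
  shows "(\<Sum>i\<in>I. \<Sum>j\<in>I. (x i * r i) * (x j * r j) * \<bar>cos (\<theta> i - \<theta> j)\<bar>)
          - 2 * (\<Sum>i\<in>I. (x i * r i)\<^sup>2) \<le> 4/3 - 4 / card I"
proof -
  define A where "A = (\<Sum>i\<in>I. x i * r i * cos (2 * \<theta> i))"
  define B where "B = (\<Sum>i\<in>I. x i * r i * sin (2 * \<theta> i))"
  \<comment> \<open>Rotating all vectors by half the argument of the moment makes the moment real and nonnegative.\<close>
  obtain m \<alpha> where m: "0 \<le> m" and AB: "A = m * cos \<alpha>" "B = m * sin \<alpha>"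
  proof
    show "0 \<le> cmod (Complex A B)" by simp
    show "A = cmod (Complex A B) * cos (Arg (Complex A B))" "B = cmod (Complex A B) * sin (Arg (Complex A B))"
      using rcis_cmod_Arg[of "Complex A B"] by (auto simp: rcis_def complex_eq_iff)
  qed
  define \<phi> where "\<phi> i = \<theta> i - \<alpha> / 2" for i
  have \<phi>2: "2 * \<phi> i = 2 * \<theta> i - \<alpha>" for i by (simp add: \<phi>_def)
  have rot_cos: "(\<Sum>i\<in>I. g i * cos (2 * \<phi> i))
      = (\<Sum>i\<in>I. g i * cos (2 * \<theta> i)) * cos \<alpha> + (\<Sum>i\<in>I. g i * sin (2 * \<theta> i)) * sin \<alpha>" for g
    unfolding \<phi>2 cos_diff by (simp add: sum_distrib_right sum.distrib distrib_left mult.assoc)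
  have rot_sin: "(\<Sum>i\<in>I. g i * sin (2 * \<phi> i))
      = (\<Sum>i\<in>I. g i * sin (2 * \<theta> i)) * cos \<alpha> - (\<Sum>i\<in>I. g i * cos (2 * \<theta> i)) * sin \<alpha>" for g
    unfolding \<phi>2 sin_diff by (simp add: sum_distrib_right sum_subtractf right_diff_distrib mult.assoc)
  have "(\<Sum>i\<in>I. (x i * r i) * cos (2 * \<phi> i)) = A * cos \<alpha> + B * sin \<alpha>"
    by (simp only: rot_cos A_def B_def)
  also have "\<dots> = m * ((cos \<alpha>)\<^sup>2 + (sin \<alpha>)\<^sup>2)"
    unfolding AB by (simp only: power2_eq_square algebra_simps)
  finally have "0 \<le> (\<Sum>i\<in>I. x i * r i * cos (2 * \<phi> i))" using m by simp
  moreover have "(\<Sum>i\<in>I. (x i * r i) * sin (2 * \<phi> i)) = B * cos \<alpha> - A * sin \<alpha>"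
    by (simp only: rot_sin A_def B_def)
  then have "(\<Sum>i\<in>I. x i * r i * sin (2 * \<phi> i)) = 0"
    by (simp add: AB)
  moreover have "(\<Sum>i\<in>I. (r i)\<^sup>2 * cos (2 * \<phi> i)) = 0"
    by (simp add: rot_cos iso)
  ultimately have "(\<Sum>i\<in>I. \<Sum>j\<in>I. (x i * r i) * (x j * r j) * \<bar>cos (\<phi> i - \<phi> j)\<bar>)
          - 2 * (\<Sum>i\<in>I. (x i * r i)\<^sup>2) \<le> 4/3 - 4 / card I"
    by (intro planar_bound_aligned N nonneg x r)
  then show ?thesis by (simp add: \<phi>_def)
qed

text \<open>
  The vectors \<open>a\<close> and \<open>b\<close> are an orthonormal basis of the kernel of an orthogonal projection matrix;
  the pairs \<open>(a\<^sub>i, b\<^sub>i)\<close> are read as planar vectors, and orthonormality says that the moment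
  \<open>\<Sum> r\<^sub>i\<^sup>2 e\<^sup>2\<^sup>i\<^sup>\<theta>\<close> vanishes. On the diagonal the absolute value is dropped by Bessel's inequality
  (the last hypothesis), which turns the diagonal terms into the term \<open>- 2 \<Sum> (x\<^sub>i r\<^sub>i)\<^sup>2\<close> of
  \<open>planar_bound\<close>.
\<close>

lemma corank_two_bound:
  fixes x a b :: "'i \<Rightarrow> real"
  assumes fin: "finite I" and N: "6 \<le> card I"
    and x0: "\<And>i. 0 \<le> x i" and x: "(\<Sum>i\<in>I. (x i)\<^sup>2) = 1"
    and a: "(\<Sum>i\<in>I. (a i)\<^sup>2) = 1" and b: "(\<Sum>i\<in>I. (b i)\<^sup>2) = 1" and ab: "(\<Sum>i\<in>I. a i * b i) = 0"
    and le1: "\<And>i. i \<in> I \<Longrightarrow> (a i)\<^sup>2 + (b i)\<^sup>2 \<le> 1"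
  shows "(\<Sum>i\<in>I. \<Sum>j\<in>I. x i * x j * \<bar>(if i = j then 1 else 0) - a i * a j - b i * b j\<bar>)
          \<le> 7/3 - 4 / card I"
proof -
  define r where "r i = cmod (Complex (a i) (b i))" for i
  define \<theta> where "\<theta> i = Arg (Complex (a i) (b i))" for i
  have ai: "a i = r i * cos (\<theta> i)" and bi: "b i = r i * sin (\<theta> i)" for i
    using rcis_cmod_Arg[of "Complex (a i) (b i)"]
    by (auto simp: r_def \<theta>_def rcis_def complex_eq_iff)
  have r0: "0 \<le> r i" for i by (simp add: r_def)
  have r2: "(r i)\<^sup>2 = (a i)\<^sup>2 + (b i)\<^sup>2" for i
    by (simp add: r_def cmod_power2)
  have "(r i)\<^sup>2 * cos (2 * \<theta> i) = (a i)\<^sup>2 - (b i)\<^sup>2" for i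
    unfolding ai[of i] bi[of i] cos_double by (simp add: power_mult_distrib right_diff_distrib)
  then have iso1: "(\<Sum>i\<in>I. (r i)\<^sup>2 * cos (2 * \<theta> i)) = 0"
    by (simp add: sum_subtractf a b)
  have "(r i)\<^sup>2 * sin (2 * \<theta> i) = 2 * (a i * b i)" for i
    unfolding ai[of i] bi[of i] sin_double by (simp add: power2_eq_square)
  then have iso2: "(\<Sum>i\<in>I. (r i)\<^sup>2 * sin (2 * \<theta> i)) = 0"
    by (simp add: ab flip: sum_distrib_left)
  have inner: "a i * a j + b i * b j = r i * r j * cos (\<theta> i - \<theta> j)" for i j
    unfolding ai[of i] bi[of i] ai[of j] bi[of j] cos_diff by (simp add: distrib_left mult_ac)
  have entry: "x i * x j * \<bar>(if i = j then 1 else 0) - a i * a j - b i * b j\<bar>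
      = (x i * r i) * (x j * r j) * \<bar>cos (\<theta> i - \<theta> j)\<bar>
        + (if i = j then (x i)\<^sup>2 - 2 * (x i * r i)\<^sup>2 else 0)" if "i \<in> I" for i j
  proof (cases "i = j")
    case True
    have "\<bar>1 - a i * a i - b i * b i\<bar> = 1 - (r i)\<^sup>2"
      using le1[OF that] r2[of i] by (simp add: power2_eq_square)
    then have e: "\<bar>(if i = i then 1 else 0) - a i * a i - b i * b i\<bar> = 1 - (r i)\<^sup>2" by simp
    show ?thesis
      unfolding True[symmetric] e by (simp add: power2_eq_square algebra_simps)
  next
    case False
    have "\<bar>- a i * a j - b i * b j\<bar> = \<bar>a i * a j + b i * b j\<bar>" by (simp add: abs_if)
    also have "\<dots> = r i * r j * \<bar>cos (\<theta> i - \<theta> j)\<bar>"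
      unfolding inner by (simp add: abs_mult r0)
    finally show ?thesis using False by simp
  qed
  have "(\<Sum>i\<in>I. \<Sum>j\<in>I. x i * x j * \<bar>(if i = j then 1 else 0) - a i * a j - b i * b j\<bar>)
    = (\<Sum>i\<in>I. \<Sum>j\<in>I. (x i * r i) * (x j * r j) * \<bar>cos (\<theta> i - \<theta> j)\<bar>
        + (if i = j then (x i)\<^sup>2 - 2 * (x i * r i)\<^sup>2 else 0))"
    by (intro sum.cong refl entry)
  also have "\<dots> = (\<Sum>i\<in>I. \<Sum>j\<in>I. (x i * r i) * (x j * r j) * \<bar>cos (\<theta> i - \<theta> j)\<bar>)
        + (1 - 2 * (\<Sum>i\<in>I. (x i * r i)\<^sup>2))"
  proof -
    have "(\<Sum>i\<in>I. \<Sum>j\<in>I. if i = j then (x i)\<^sup>2 - 2 * (x i * r i)\<^sup>2 else 0)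
        = (\<Sum>i\<in>I. (x i)\<^sup>2 - 2 * (x i * r i)\<^sup>2)"
      using fin by simp
    then show ?thesis by (simp only: sum.distrib sum_subtractf x flip: sum_distrib_left)
  qed
  also have "\<dots> \<le> 7/3 - 4 / card I"
    using planar_bound[OF N x0 r0 x _ iso1 iso2] by (simp add: r2 sum.distrib a b)
  finally show ?thesis .
qed

section \<open>Projections of small norm onto subspaces of codimension two\<close>

text \<open>
  The matrix is that of the projection onto \<open>E\<close> which is orthogonal for the inner product with
  weights \<open>x\<^sub>i\<^sup>2\<close>: scaling by \<open>x\<close> turns it into an ordinary orthogonal projection \<open>U\<close>, and it makes the
  weighted sum of row sums symmetric in the two indices.
\<close>

lemma weighted_projection:
  fixes E :: "(real^'n) set" and x :: "real^'n"
  assumes E: "subspace E" "dim E + 2 = CARD('n)" and N: "6 \<le> CARD('n)"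
    and pos: "\<And>i. 0 < x $ i" and x: "(\<Sum>i\<in>UNIV. (x $ i)\<^sup>2) = 1"
  shows "\<exists>A::real^'n^'n. (\<forall>y. A *v y \<in> E) \<and> (\<forall>y\<in>E. A *v y = y) \<and>
    (\<Sum>i\<in>UNIV. (x $ i)\<^sup>2 * (\<Sum>j\<in>UNIV. \<bar>A $ i $ j\<bar>)) \<le> 7/3 - 4 / CARD('n)"
proof -
  have x0: "x $ i \<noteq> 0" for i using pos[of i] by simp
  define D :: "real^'n \<Rightarrow> real^'n" where "D y = (\<chi> i. x $ i * y $ i)" for y
  define D' :: "real^'n \<Rightarrow> real^'n" where "D' y = (\<chi> i. y $ i / x $ i)" for y
  have D'D: "D' (D y) = y" for y by (simp add: D_def D'_def vec_eq_iff x0)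
  have lin: "linear D"
    by (rule linearI) (simp_all add: D_def vec_eq_iff algebra_simps)
  have inj: "inj_on D S" for S using D'D by (metis inj_onI)
  define F where "F = D ` E"
  have subF: "subspace F" unfolding F_def by (rule linear_subspace_image[OF lin E(1)])
  have dimF: "dim F = dim E" unfolding F_def by (rule dim_image_eq[OF lin inj])
  have "dim {y \<in> UNIV. \<forall>z\<in>F. orthogonal z y} + dim F = dim (UNIV :: (real^'n) set)"
    by (rule dim_subspace_orthogonal_to_vectors) (use subF in auto)
  then have "dim (F\<^sup>\<bottom>) = 2" using dimF E(2) by (simp add: orthogonal_comp_def)
  moreover obtain B where "B \<subseteq> F\<^sup>\<bottom>"
      and B: "pairwise orthogonal B" "\<And>v. v \<in> B \<Longrightarrow> norm v = 1"
      and "independent B" and "card B = dim (F\<^sup>\<bottom>)" and spanB: "span B = F\<^sup>\<bottom>"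
    by (rule orthonormal_basis_subspace[OF subspace_orthogonal_comp[of F]]) (rule that)
  ultimately obtain a b where ab: "B = {a, b}" "a \<noteq> b" by (auto simp: card_2_iff)
  have inner: "a \<bullet> a = 1" "b \<bullet> b = 1" "a \<bullet> b = 0" "b \<bullet> a = 0"
    using B(1,2) ab by (auto simp: pairwise_def orthogonal_def norm_eq_1)
  define p where "p y = y - (a \<bullet> y) *\<^sub>R a - (b \<bullet> y) *\<^sub>R b" for y
  have p_in: "p y \<in> F" for y
  proof -
    have "orthogonal (p y) z" if "z \<in> B" for z
    proof -
      have "z = a \<or> z = b" using that ab(1) by blast
      moreover have "p y \<bullet> a = 0" "p y \<bullet> b = 0"
        by (simp_all add: p_def inner_diff_left inner inner_commute[of y])
      ultimately show ?thesis unfolding orthogonal_def by blast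
    qed
    then have "orthogonal (p y) z" if "z \<in> F\<^sup>\<bottom>" for z
      using orthogonal_to_span[of z B "p y"] that spanB by simp
    then have "p y \<in> F\<^sup>\<bottom>\<^sup>\<bottom>"
      by (simp add: orthogonal_comp_def[of "F\<^sup>\<bottom>"] orthogonal_commute)
    then show ?thesis by (simp add: orthogonal_comp_self subF)
  qed
  have p_id: "p y = y" if "y \<in> F" for y
  proof -
    have "a \<in> F\<^sup>\<bottom>" "b \<in> F\<^sup>\<bottom>" unfolding spanB[symmetric] ab(1) by (simp_all add: span_base)
    then have "y \<bullet> a = 0" "y \<bullet> b = 0"
      using that by (simp_all add: orthogonal_comp_def orthogonal_def)
    then show ?thesis by (simp add: p_def inner_commute[of _ y])
  qed
  define U where "U i j = (if i = j then 1 else 0) - a $ i * a $ j - b $ i * b $ j" for i j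
  define A :: "real^'n^'n" where "A = (\<chi> i j. U i j * x $ j / x $ i)"
  have sums: "(\<Sum>i\<in>UNIV. (a $ i)\<^sup>2) = 1" "(\<Sum>i\<in>UNIV. (b $ i)\<^sup>2) = 1" "(\<Sum>i\<in>UNIV. a $ i * b $ i) = 0"
    using inner by (auto simp: inner_vec_def power2_eq_square)
  have bessel: "(a $ i)\<^sup>2 + (b $ i)\<^sup>2 \<le> 1" for i
  proof -
    have ax: "axis i 1 \<bullet> axis i (1::real) = 1" "a \<bullet> axis i 1 = a $ i" "b \<bullet> axis i 1 = b $ i"
      "axis i 1 \<bullet> a = a $ i" "axis i 1 \<bullet> b = b $ i"
      by (simp_all add: inner_axis inner_axis_axis inner_commute[of "axis i 1"])
    have "0 \<le> p (axis i 1) \<bullet> p (axis i 1)" by simp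
    also have "\<dots> = 1 - (a $ i)\<^sup>2 - (b $ i)\<^sup>2"
      by (simp add: p_def inner_diff_left inner_diff_right inner ax power2_eq_square)
    finally show ?thesis by simp
  qed
  have Av: "A *v y = D' (p (D y))" for y
  proof -
    have "(\<Sum>j\<in>UNIV. U i j * (x $ j * y $ j)) = p (D y) $ i" for i
    proof -
      have "(\<Sum>j\<in>UNIV. U i j * (x $ j * y $ j)) =
        (\<Sum>j\<in>UNIV. (if i = j then x $ j * y $ j else 0) - a $ i * (a $ j * (x $ j * y $ j))
            - b $ i * (b $ j * (x $ j * y $ j)))"
        by (intro sum.cong) (auto simp: U_def algebra_simps)
      also have "\<dots> = p (D y) $ i"
        by (simp add: sum_subtractf p_def D_def inner_vec_def mult.commute flip: sum_distrib_left)
      finally show ?thesis .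
    qed
    moreover have "(A *v y) $ i = (\<Sum>j\<in>UNIV. U i j * (x $ j * y $ j)) / x $ i" for i
      by (simp add: matrix_vector_mult_def A_def sum_divide_distrib mult.assoc)
    ultimately show ?thesis by (simp add: vec_eq_iff D'_def)
  qed
  have "A *v y \<in> E" for y
    using p_in[of "D y"] D'D by (auto simp: Av F_def)
  moreover have "A *v y = y" if "y \<in> E" for y
    using that p_id[of "D y"] by (simp add: Av F_def D'D)
  moreover have "(\<Sum>i\<in>UNIV. (x $ i)\<^sup>2 * (\<Sum>j\<in>UNIV. \<bar>A $ i $ j\<bar>)) \<le> 7/3 - 4 / CARD('n)"
  proof -
    have "(x $ i)\<^sup>2 * \<bar>A $ i $ j\<bar> = x $ i * x $ j * \<bar>U i j\<bar>" for i j
      using pos[of i] pos[of j] by (simp add: A_def abs_mult power2_eq_square)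
    then have "(\<Sum>i\<in>UNIV. (x $ i)\<^sup>2 * (\<Sum>j\<in>UNIV. \<bar>A $ i $ j\<bar>))
       = (\<Sum>i\<in>UNIV. \<Sum>j\<in>UNIV. x $ i * x $ j * \<bar>U i j\<bar>)"
      by (simp add: sum_distrib_left)
    also have "\<dots> \<le> 7/3 - 4 / CARD('n)"
      unfolding U_def
      by (rule corank_two_bound) (use N pos x sums bessel in \<open>auto simp: less_imp_le\<close>)
    finally show ?thesis .
  qed
  ultimately show ?thesis by blast
qed

text \<open>
  If every projection had a row sum above the bound, the convex set of vectors that dominate the
  row sums of some projection would be separated from the orthant of vectors bounded by
  \<open>7/3 - 4/d + e\<close>. As the first set is closed upwards, the separating functional is a nonnegative
  weight, and mixing it with a little of the uniform weight gives a positive weight that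
  contradicts \<open>weighted_projection\<close>.
\<close>

lemma small_projection:
  fixes E :: "(real^'n) set"
  assumes E: "subspace E" "dim E + 2 = CARD('n)" and N: "6 \<le> CARD('n)" and e: "0 < e"
  shows "\<exists>A::real^'n^'n. (\<forall>y. A *v y \<in> E) \<and> (\<forall>y\<in>E. A *v y = y) \<and>
    (\<forall>i. (\<Sum>j\<in>UNIV. \<bar>A $ i $ j\<bar>) \<le> 7/3 - 4 / CARD('n) + e)"
proof (rule ccontr)
  define c where "c = 7/3 - 4 / real CARD('n)"
  define N where "N = real CARD('n)"
  have N6: "6 \<le> N" using N by (simp add: N_def)
  have c1: "1 \<le> c" using N6 by (simp add: c_def field_simps flip: N_def)
  define P :: "(real^'n^'n) set" where "P = {A. (\<forall>y. A *v y \<in> E) \<and> (\<forall>y\<in>E. A *v y = y)}"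
  define row where "row A i = (\<Sum>j\<in>UNIV. \<bar>A $ i $ j\<bar>)" for A :: "real^'n^'n" and i
  assume "\<not> ?thesis"
  then have big: "\<exists>i. c + e < row A i" if "A \<in> P" for A
    using that by (fastforce simp: P_def c_def row_def not_le)
  have bound: "\<exists>A\<in>P. (\<Sum>i\<in>UNIV. \<nu> i * row A i) \<le> c"
    if \<nu>: "\<And>i. 0 < \<nu> i" "(\<Sum>i\<in>UNIV. \<nu> i) = 1" for \<nu> :: "'n \<Rightarrow> real"
  proof -
    have "(sqrt (\<nu> i))\<^sup>2 = \<nu> i" for i using \<nu>(1)[of i] by simp
    then show ?thesis
      using weighted_projection[OF E N, of "\<chi> i. sqrt (\<nu> i)"] \<nu>
      by (auto simp: P_def row_def c_def)
  qed
  define S :: "(real^'n) set" where "S = {y. \<exists>A\<in>P. \<forall>i. row A i \<le> y $ i}"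
  define T :: "(real^'n) set" where "T = {y. \<forall>i. y $ i \<le> c + e}"
  have "convex S"
  proof (rule convexI)
    fix y z :: "real^'n" and u v :: real
    assume yz: "y \<in> S" "z \<in> S" and uv: "0 \<le> u" "0 \<le> v" "u + v = 1"
    then obtain A B where A: "A \<in> P" "\<And>i. row A i \<le> y $ i" and B: "B \<in> P" "\<And>i. row B i \<le> z $ i"
      by (auto simp: S_def)
    have mult: "(u *\<^sub>R A + v *\<^sub>R B) *v w = u *\<^sub>R (A *v w) + v *\<^sub>R (B *v w)" for w
      by (simp add: matrix_vector_mult_add_rdistrib scaleR_matrix_vector_assoc)
    have "u *\<^sub>R A + v *\<^sub>R B \<in> P"
      using A(1) B(1) uv E(1)
      by (auto simp: P_def mult subspace_add subspace_scale simp flip: scaleR_left_distrib)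
    moreover have "row (u *\<^sub>R A + v *\<^sub>R B) i \<le> (u *\<^sub>R y + v *\<^sub>R z) $ i" for i
    proof -
      have "row (u *\<^sub>R A + v *\<^sub>R B) i \<le> (\<Sum>j\<in>UNIV. u * \<bar>A $ i $ j\<bar> + v * \<bar>B $ i $ j\<bar>)"
      proof -
        have "\<bar>u * a + v * b\<bar> \<le> u * \<bar>a\<bar> + v * \<bar>b\<bar>" for a b
          using abs_triangle_ineq[of "u * a" "v * b"] uv by (simp add: abs_mult)
        then show ?thesis unfolding row_def by (auto intro!: sum_mono)
      qed
      also have "\<dots> = u * row A i + v * row B i"
        by (simp add: row_def sum.distrib sum_distrib_left)
      also have "\<dots> \<le> u * y $ i + v * z $ i"
        by (intro add_mono mult_left_mono A B uv)
      finally show ?thesis by simp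
    qed
    ultimately show "u *\<^sub>R y + v *\<^sub>R z \<in> S" unfolding S_def by blast
  qed
  moreover have "convex T"
  proof (rule convexI)
    fix y z :: "real^'n" and u v :: real
    assume "y \<in> T" "z \<in> T" "0 \<le> u" "0 \<le> v" "u + v = 1"
    then show "u *\<^sub>R y + v *\<^sub>R z \<in> T"
      by (auto simp: T_def intro!: convex_bound_le)
  qed
  moreover have "T \<noteq> {}" by (auto simp: T_def intro!: exI[of _ "\<chi> i. c + e"])
  moreover have "S \<noteq> {}"
  proof -
    obtain A where "A \<in> P" using bound[of "\<lambda>_. 1 / N"] N6 by (auto simp: N_def)
    then have "(\<chi> i. row A i) \<in> S" by (auto simp: S_def)
    then show ?thesis by blast
  qed
  moreover have "T \<inter> S = {}"
  proof -
    have False if y: "y \<in> T" and A: "A \<in> P" "\<And>i. row A i \<le> y $ i" for y A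
    proof -
      obtain i where "c + e < row A i" using big[OF A(1)] by blast
      also have "\<dots> \<le> y $ i" by (rule A)
      also have "\<dots> \<le> c + e" using y by (simp add: T_def)
      finally show False by simp
    qed
    then show ?thesis by (auto simp: S_def)
  qed
  ultimately obtain \<mu> \<beta> where \<mu>: "\<mu> \<noteq> 0" and
      T: "\<And>y. y \<in> T \<Longrightarrow> \<mu> \<bullet> y \<le> \<beta>" and S: "\<And>y. y \<in> S \<Longrightarrow> \<beta> \<le> \<mu> \<bullet> y"
    using separating_hyperplane_sets[of T S] by blast
  obtain A0 where A0: "A0 \<in> P" using bound[of "\<lambda>_. 1 / N"] N6 by (auto simp: N_def)
  have \<mu>0: "0 \<le> \<mu> $ k" for k
  proof (rule ccontr)
    assume neg: "\<not> 0 \<le> \<mu> $ k"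
    define y0 :: "real^'n" where "y0 = (\<chi> i. row A0 i)"
    define t where "t = (\<mu> \<bullet> y0 - \<beta> + 1) / (- (\<mu> $ k))"
    have "\<beta> \<le> \<mu> \<bullet> y0" by (rule S) (use A0 in \<open>auto simp: S_def y0_def\<close>)
    then have "0 \<le> t" unfolding t_def by (intro divide_nonneg_pos) (use neg in auto)
    then have "\<beta> \<le> \<mu> \<bullet> (y0 + t *\<^sub>R axis k 1)"
      by (intro S) (use A0 in \<open>auto simp: S_def y0_def axis_def intro!: bexI[of _ A0]\<close>)
    also have "\<dots> = \<mu> \<bullet> y0 + t * \<mu> $ k" by (simp add: inner_add_right inner_axis)
    also have "\<dots> = \<beta> - 1" using neg by (simp add: t_def field_simps)
    finally show False by simp
  qed
  define m where "m = (\<Sum>i\<in>UNIV. \<mu> $ i)"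
  have m: "0 < m"
  proof -
    obtain k where "\<mu> $ k \<noteq> 0" using \<mu> by (auto simp: vec_eq_iff)
    then have "0 < \<mu> $ k" using \<mu>0[of k] by simp
    then show ?thesis unfolding m_def by (intro sum_pos2[of _ k]) (use \<mu>0 in auto)
  qed
  have lower: "m * (c + e) \<le> (\<Sum>i\<in>UNIV. \<mu> $ i * row A i)" if "A \<in> P" for A
  proof -
    have "\<mu> \<bullet> (\<chi> i. c + e) \<le> \<beta>" by (rule T) (simp add: T_def)
    also have "\<beta> \<le> \<mu> \<bullet> (\<chi> i. row A i)" by (rule S) (use that in \<open>auto simp: S_def\<close>)
    finally show ?thesis by (simp add: inner_vec_def m_def sum_distrib_right)
  qed
  \<comment> \<open>The value of \<open>\<delta>\<close> solves \<open>(1 - \<delta>) (c + e) = c + e / 2\<close>, so half of the excess survives the mixing.\<close>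
  define \<delta> where "\<delta> = e / (2 * (c + e))"
  have \<delta>: "0 < \<delta>" "\<delta> < 1" using c1 e by (auto simp: \<delta>_def field_simps)
  define \<nu> where "\<nu> i = (1 - \<delta>) * (\<mu> $ i / m) + \<delta> / N" for i
  have "0 < \<nu> i" for i
    using \<delta> m \<mu>0[of i] N6 unfolding \<nu>_def by (intro add_nonneg_pos mult_nonneg_nonneg) auto
  moreover have "(\<Sum>i\<in>UNIV. \<nu> i) = 1"
    using m N6 by (simp add: \<nu>_def sum.distrib N_def flip: sum_distrib_left sum_divide_distrib m_def)
  ultimately obtain A where A: "A \<in> P" "(\<Sum>i\<in>UNIV. \<nu> i * row A i) \<le> c" using bound by blast
  have row0: "0 \<le> row A i" for i by (simp add: row_def sum_nonneg)
  have "(1 - \<delta>) * (c + e) = (1 - \<delta>) / m * (m * (c + e))" using m by simp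
  also have "\<dots> \<le> (1 - \<delta>) / m * (\<Sum>i\<in>UNIV. \<mu> $ i * row A i)"
    by (intro mult_left_mono lower A) (use \<delta> m in auto)
  also have "\<dots> = (\<Sum>i\<in>UNIV. (1 - \<delta>) * (\<mu> $ i / m) * row A i)"
    by (simp add: sum_distrib_left mult.assoc)
  also have "\<dots> \<le> (\<Sum>i\<in>UNIV. \<nu> i * row A i)"
    by (intro sum_mono mult_right_mono row0) (use \<delta> N6 in \<open>simp add: \<nu>_def\<close>)
  also have "\<dots> \<le> c" by (rule A)
  finally have "(1 - \<delta>) * (c + e) \<le> c" .
  moreover have "(1 - \<delta>) * (c + e) = c + e / 2"
    using c1 e by (simp add: \<delta>_def field_simps)
  ultimately show False using e by simp
qed

section \<open>Extension of contractions into the space of bounded sequences\<close>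

text \<open>
  Zorn's lemma is applied to graphs of functionals, as linear subspaces of the product with \<open>\<real>\<close>. The
  one-sided bound \<open>r \<le> norm x\<close> on such a subspace already implies that it is the graph of a function:
  it forces \<open>r = 0\<close> whenever \<open>x = 0\<close>.
\<close>

lemma hahn_banach_norm:
  fixes f :: "'a::real_normed_vector \<Rightarrow> real"
  assumes S: "subspace S" and f: "linear f" and le: "\<And>x. x \<in> S \<Longrightarrow> \<bar>f x\<bar> \<le> norm x"
  obtains g where "linear g" "\<And>x. \<bar>g x\<bar> \<le> norm x" "\<And>x. x \<in> S \<Longrightarrow> g x = f x"
proof -
  define \<G> :: "('a \<times> real) set set" where
    "\<G> = {G. subspace G \<and> (\<lambda>x. (x, f x)) ` S \<subseteq> G \<and> (\<forall>(x, r)\<in>G. r \<le> norm x)}"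
  have "linear (\<lambda>x. (x, f x))" using f by (auto simp: linear_iff)
  then have "subspace ((\<lambda>x. (x, f x)) ` S)" using S by (rule linear_subspace_image)
  then have G0: "(\<lambda>x. (x, f x)) ` S \<in> \<G>" using le by (auto simp: \<G>_def abs_le_iff)
  have "\<exists>M\<in>\<G>. \<forall>X\<in>\<G>. M \<subseteq> X \<longrightarrow> X = M"
  proof (rule subset_Zorn_nonempty)
    show "\<G> \<noteq> {}" using G0 by blast
    fix \<C> assume ne: "\<C> \<noteq> {}" and chain: "subset.chain \<G> \<C>"
    have sub: "\<C> \<subseteq> \<G>" and tot: "\<And>X Y. X \<in> \<C> \<Longrightarrow> Y \<in> \<C> \<Longrightarrow> X \<subseteq> Y \<or> Y \<subseteq> X"
      using chain by (auto simp: subset_chain_def)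
    have subC: "\<And>X. X \<in> \<C> \<Longrightarrow> subspace X" using sub by (auto simp: \<G>_def)
    have "subspace (\<Union>\<C>)"
    proof (rule subspaceI)
      show "0 \<in> \<Union>\<C>" using ne subC subspace_0 by blast
    next
      fix u v assume "u \<in> \<Union>\<C>" "v \<in> \<Union>\<C>"
      then obtain X where "X \<in> \<C>" "u \<in> X" "v \<in> X" using tot by blast
      then show "u + v \<in> \<Union>\<C>" using subC subspace_add by blast
    next
      fix c :: real and u assume "u \<in> \<Union>\<C>"
      then show "c *\<^sub>R u \<in> \<Union>\<C>" using subC subspace_scale by blast
    qed
    moreover have "(\<lambda>x. (x, f x)) ` S \<subseteq> \<Union>\<C>" using ne sub by (auto simp: \<G>_def)
    moreover have "\<forall>(x, r)\<in>\<Union>\<C>. r \<le> norm x" using sub by (auto simp: \<G>_def)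
    ultimately show "\<Union>\<C> \<in> \<G>" by (simp add: \<G>_def)
  qed
  then obtain M where M: "M \<in> \<G>" and max: "\<And>X. X \<in> \<G> \<Longrightarrow> M \<subseteq> X \<Longrightarrow> X = M" by blast
  have subM: "subspace M" and SM: "\<And>x. x \<in> S \<Longrightarrow> (x, f x) \<in> M"
    and normM: "\<And>x r. (x, r) \<in> M \<Longrightarrow> r \<le> norm x"
    using M by (auto simp: \<G>_def)
  have addM: "(x + y, r + s) \<in> M" if "(x, r) \<in> M" "(y, s) \<in> M" for x y r s
    using subspace_add[OF subM that] by simp
  have scaleM: "(c *\<^sub>R x, c * r) \<in> M" if "(x, r) \<in> M" for c x r
    using subspace_scale[OF subM that, of c] by simp
  have total: "\<exists>r. (x0, r) \<in> M" for x0
  proof -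
    \<comment> \<open>The usual one-dimensional extension step: the admissible values at \<open>x0\<close> are those between the
      numbers in \<open>L\<close> and the numbers \<open>norm (y + x0) - s\<close>.\<close>
    define L where "L = (\<lambda>(x, r). r - norm (x - x0)) ` M"
    have M0: "(0, 0) \<in> M" using subspace_0[OF subM] by (simp add: zero_prod_def)
    have sep: "r - norm (x - x0) \<le> norm (y + x0) - s" if "(x, r) \<in> M" "(y, s) \<in> M" for x y r s
    proof -
      have "r + s \<le> norm (x + y)" by (rule normM[OF addM[OF that]])
      also have "\<dots> \<le> norm (x - x0) + norm (y + x0)"
        using norm_triangle_ineq[of "x - x0" "y + x0"] by simp
      finally show ?thesis by simp
    qed
    have ne: "L \<noteq> {}" using M0 by (auto simp: L_def)
    have bdd: "bdd_above L" using sep[OF _ M0] by (auto simp: L_def intro!: bdd_aboveI2)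
    define a where "a = Sup L"
    have lower: "r - norm (x - x0) \<le> a" if "(x, r) \<in> M" for x r
      unfolding a_def by (rule cSup_upper[OF _ bdd]) (use that in \<open>force simp: L_def\<close>)
    have upper: "a \<le> norm (y + x0) - s" if "(y, s) \<in> M" for y s
      unfolding a_def by (rule cSup_least[OF ne]) (use sep[OF _ that] in \<open>auto simp: L_def\<close>)
    define X where "X = {(x + t *\<^sub>R x0, r + t * a) | x r t. (x, r) \<in> M}"
    have "subspace X"
    proof (rule subspaceI)
      show "0 \<in> X" using M0 unfolding X_def zero_prod_def
        by (intro CollectI exI[of _ 0]) simp
    next
      fix u v assume "u \<in> X" "v \<in> X"
      then obtain x r t y s t' where "u = (x + t *\<^sub>R x0, r + t * a)" "(x, r) \<in> M"
          "v = (y + t' *\<^sub>R x0, s + t' * a)" "(y, s) \<in> M" by (auto simp: X_def)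
      then show "u + v \<in> X"
        unfolding X_def using addM[of x r y s]
        by (intro CollectI exI[of _ "x + y"] exI[of _ "r + s"] exI[of _ "t + t'"])
          (simp add: algebra_simps)
    next
      fix c :: real and u assume "u \<in> X"
      then obtain x r t where "u = (x + t *\<^sub>R x0, r + t * a)" "(x, r) \<in> M" by (auto simp: X_def)
      then show "c *\<^sub>R u \<in> X"
        unfolding X_def using scaleM[of x r c]
        by (intro CollectI exI[of _ "c *\<^sub>R x"] exI[of _ "c * r"] exI[of _ "c * t"])
          (simp add: algebra_simps)
    qed
    have MX: "M \<subseteq> X"
    proof clarify
      fix x r assume "(x, r) \<in> M"
      then show "(x, r) \<in> X"
        unfolding X_def by (intro CollectI exI[of _ x] exI[of _ r] exI[of _ 0]) simp
    qed
    have "r + t * a \<le> norm (x + t *\<^sub>R x0)" if xr: "(x, r) \<in> M" for x r t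
    proof -
      consider "t = 0" | "0 < t" | "t < 0" by linarith
      then show ?thesis
      proof cases
        case 1
        then show ?thesis using normM[OF xr] by simp
      next
        case 2
        have "a \<le> norm (inverse t *\<^sub>R x + x0) - inverse t * r" by (rule upper[OF scaleM[OF xr]])
        then have "t * a \<le> t * norm (inverse t *\<^sub>R x + x0) - t * (inverse t * r)"
          using 2 by (simp flip: right_diff_distrib)
        also have "t * norm (inverse t *\<^sub>R x + x0) = norm (t *\<^sub>R (inverse t *\<^sub>R x + x0))"
          using 2 by simp
        also have "t *\<^sub>R (inverse t *\<^sub>R x + x0) = x + t *\<^sub>R x0"
          using 2 by (simp add: scaleR_right_distrib)
        also have "t * (inverse t * r) = r" using 2 by simp
        finally show ?thesis by simp
      next
        case 3
        define u where "u = - t"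
        have u: "0 < u" "t = - u" using 3 by (auto simp: u_def)
        have "inverse u * r - norm (inverse u *\<^sub>R x - x0) \<le> a" by (rule lower[OF scaleM[OF xr]])
        then have "u * (inverse u * r - norm (inverse u *\<^sub>R x - x0)) \<le> u * a"
          using u by simp
        then have "u * (inverse u * r) - u * norm (inverse u *\<^sub>R x - x0) \<le> u * a"
          by (simp only: right_diff_distrib)
        also have "u * norm (inverse u *\<^sub>R x - x0) = norm (u *\<^sub>R (inverse u *\<^sub>R x - x0))"
          using u by simp
        also have "u *\<^sub>R (inverse u *\<^sub>R x - x0) = x + t *\<^sub>R x0"
          using u by (simp add: scaleR_right_diff_distrib)
        also have "u * (inverse u * r) = r" using u by simp
        finally show ?thesis using u by simp
      qed
    qed
    then have "\<forall>(x, r)\<in>X. r \<le> norm x" by (auto simp: X_def)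
    then have "X = M"
      using max[OF _ MX] \<open>subspace X\<close> SM MX by (auto simp: \<G>_def)
    moreover have "(x0, a) \<in> X"
      unfolding X_def using M0 by (intro CollectI exI[of _ 0] exI[of _ 1]) simp
    ultimately show ?thesis by blast
  qed
  have unique: "r = s" if "(x, r) \<in> M" "(x, s) \<in> M" for x r s
  proof -
    have "r - s \<le> 0" "s - r \<le> 0"
      using normM[OF addM[OF that(1) scaleM[OF that(2), of "-1"]]]
        normM[OF addM[OF that(2) scaleM[OF that(1), of "-1"]]] by simp_all
    then show ?thesis by simp
  qed
  obtain g where g: "\<And>x. (x, g x) \<in> M" using total by metis
  have gI: "g x = r" if "(x, r) \<in> M" for x r using unique[OF g that] .
  have "linear g"
    by (rule linearI) (auto intro!: gI addM scaleM g)
  moreover have "\<bar>g x\<bar> \<le> norm x" for x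
    using normM[OF g, of x] normM[OF scaleM[OF g, of "-1" x]] by simp
  moreover have "g x = f x" if "x \<in> S" for x using gI[OF SM[OF that]] .
  ultimately show thesis by (rule that)
qed

lemma apply_Bcontfun:
  fixes f :: "nat \<Rightarrow> real"
  assumes "\<And>i. \<bar>f i\<bar> \<le> B"
  shows "apply_bcontfun (Bcontfun f) = f"
proof (rule Bcontfun_inverse)
  have "bounded (range f)" using assms by (auto simp: bounded_iff)
  then show "f \<in> bcontfun" by (simp add: bcontfun_def)
qed

lemma linf_extend_contraction:
  fixes T :: "'a::real_normed_vector \<Rightarrow> linf"
  assumes S: "subspace S" and T: "linear T" and le: "\<And>x. x \<in> S \<Longrightarrow> norm (T x) \<le> norm x"
  obtains T' where "linear T'" "\<And>x. norm (T' x) \<le> norm x" "\<And>x. x \<in> S \<Longrightarrow> T' x = T x"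
proof -
  have "\<exists>g. linear g \<and> (\<forall>x. \<bar>g x\<bar> \<le> norm x) \<and> (\<forall>x\<in>S. g x = apply_bcontfun (T x) n)" for n
  proof -
    have "linear (\<lambda>x. apply_bcontfun (T x) n)"
      by (rule linearI) (simp_all add: linear_add[OF T] linear_scale[OF T])
    moreover have "\<bar>apply_bcontfun (T x) n\<bar> \<le> norm x" if "x \<in> S" for x
      using norm_bounded[of "T x" n] le[OF that] by simp
    ultimately show ?thesis by (rule hahn_banach_norm[OF S]) auto
  qed
  then obtain g where g: "\<And>n. linear (g n)" "\<And>n x. \<bar>g n x\<bar> \<le> norm x"
      "\<And>n x. x \<in> S \<Longrightarrow> g n x = apply_bcontfun (T x) n" by metis
  define T' where "T' x = Bcontfun (\<lambda>n. g n x)" for x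
  have app: "apply_bcontfun (T' x) n = g n x" for x n
    unfolding T'_def by (subst apply_Bcontfun[OF g(2)]) simp
  have "linear T'"
    by (intro linearI bcontfun_eqI) (simp_all add: app linear_add[OF g(1)] linear_scale[OF g(1)])
  moreover have "norm (T' x) \<le> norm x" for x
    by (rule norm_bound) (simp add: app g(2))
  moreover have "T' x = T x" if "x \<in> S" for x
    by (rule bcontfun_eqI) (simp add: app g(3)[OF that])
  ultimately show thesis by (rule that)
qed

section \<open>Independence of the embedding\<close>

lemma fixed_embedding_linf:
  fixes E :: "linf set"
  assumes E: "subspace E"
  obtains L where "linear (fixed_embedding E)" "\<And>x. x \<in> E \<Longrightarrow> norm (fixed_embedding E x) = norm x"
    "linear L" "\<And>y. L y \<in> E" "\<And>x. x \<in> E \<Longrightarrow> L (fixed_embedding E x) = x"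
proof -
  have "isometric_embedding E (\<lambda>x. x)" by (simp add: isometric_embedding_def linear_iff)
  then have "isometric_embedding E (fixed_embedding E)"
    unfolding fixed_embedding_def by (rule someI[where P = "isometric_embedding E"])
  then have J: "linear (fixed_embedding E)" "\<And>x. x \<in> E \<Longrightarrow> norm (fixed_embedding E x) = norm x"
    by (auto simp: isometric_embedding_def)
  have "inj_on (fixed_embedding E) E"
  proof (rule inj_onI)
    fix x y assume "x \<in> E" "y \<in> E" "fixed_embedding E x = fixed_embedding E y"
    then show "x = y"
      using J(2)[OF subspace_diff[OF E, of x y]] by (simp add: linear_diff[OF J(1)])
  qed
  then obtain L where "range L \<subseteq> E" "linear L" "\<forall>x\<in>E. L (fixed_embedding E x) = x"
    using real_vector.linear_exists_left_inverse_on[OF J(1) E] by metis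
  then show thesis using that J by blast
qed

text \<open>
  The isometry from the embedded copy back to \<open>E\<close> extends to a contraction \<open>T\<close> of the whole space, and
  the projection sought is \<open>T\<close> followed by \<open>Q\<close> and the embedding.
\<close>

lemma projection_transfer_to:
  fixes E :: "linf set"
  assumes E: "subspace E" and Q: "linear Q" "\<And>x. Q x \<in> E" "\<And>x. x \<in> E \<Longrightarrow> Q x = x"
    and norm_Q: "\<And>x. norm (Q x) \<le> c * norm x" and c: "0 \<le> c"
  shows "\<exists>P\<in>projections_onto (fixed_embedding E ` E). norm P \<le> c"
proof -
  define J where "J = fixed_embedding E"
  obtain L where J: "linear J" "\<And>x. x \<in> E \<Longrightarrow> norm (J x) = norm x"
    and L: "linear L" "\<And>y. L y \<in> E" "\<And>x. x \<in> E \<Longrightarrow> L (J x) = x"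
    by (rule fixed_embedding_linf[OF E, folded J_def]) (rule that)
  have norm_L: "norm (L y) \<le> norm y" if "y \<in> J ` E" for y using that J(2) L(3) by auto
  obtain T where T: "linear T" "\<And>x. norm (T x) \<le> norm x" "\<And>y. y \<in> J ` E \<Longrightarrow> T y = L y"
    by (rule linf_extend_contraction[OF linear_subspace_image[OF J(1) E] L(1) norm_L]) (assumption, rule that)
  have TJ: "T (J x) = x" if "x \<in> E" for x using T(3)[of "J x"] L(3)[OF that] that by simp
  define p where "p y = J (Q (T y))" for y
  have "linear p"
    unfolding p_def by (rule linearI) (simp_all add: linear_add[OF T(1)] linear_add[OF Q(1)] linear_add[OF J(1)]
        linear_scale[OF T(1)] linear_scale[OF Q(1)] linear_scale[OF J(1)])
  have norm_p: "norm (p y) \<le> c * norm y" for y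
  proof -
    have "norm (p y) \<le> c * norm (T y)" unfolding p_def using J(2)[OF Q(2)] norm_Q by simp
    also have "\<dots> \<le> c * norm y" by (intro mult_left_mono T(2) c)
    finally show ?thesis .
  qed
  have "bounded_linear p"
    using \<open>linear p\<close> norm_p by (intro bounded_linear.intro bounded_linear_axioms.intro) (auto simp: mult.commute)
  then have app: "blinfun_apply (Blinfun p) = p" by (rule bounded_linear_Blinfun_apply)
  have p_id: "p (J x) = J x" if "x \<in> E" for x using that by (simp add: p_def TJ Q(3))
  have p_in: "p y \<in> J ` E" for y by (simp add: p_def Q(2))
  have "range p = J ` E" using p_id p_in by (auto simp: image_iff) metis
  moreover have "p (p y) = p y" for y
  proof -
    obtain x where "x \<in> E" "p y = J x" using p_in by blast
    then show ?thesis by (simp add: p_id)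
  qed
  then have "Blinfun p o\<^sub>L Blinfun p = Blinfun p"
    by (intro blinfun_eqI) (simp add: app)
  ultimately have "Blinfun p \<in> projections_onto (J ` E)" by (simp add: projections_onto_def app)
  moreover have "norm (Blinfun p) \<le> c"
    by (rule norm_blinfun_bound[OF c]) (simp add: app norm_p)
  ultimately show ?thesis unfolding J_def by blast
qed

text \<open>
  The reverse passage extends the embedding of \<open>E\<close> to a contraction \<open>T\<close> and composes it with \<open>P\<close> and the
  inverse of the embedding.
\<close>

lemma projection_transfer_from:
  fixes E :: "linf set"
  assumes E: "subspace E" and P: "P \<in> projections_onto (fixed_embedding E ` E)"
  obtains Q where "linear Q" "\<And>x. Q x \<in> E" "\<And>x. x \<in> E \<Longrightarrow> Q x = x"
    "\<And>x. norm (Q x) \<le> norm P * norm x"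
proof -
  define J where "J = fixed_embedding E"
  obtain L where J: "linear J" "\<And>x. x \<in> E \<Longrightarrow> norm (J x) = norm x"
    and L: "linear L" "\<And>y. L y \<in> E" "\<And>x. x \<in> E \<Longrightarrow> L (J x) = x"
    by (rule fixed_embedding_linf[OF E, folded J_def]) (rule that)
  have norm_J: "norm (J x) \<le> norm x" if "x \<in> E" for x using J(2)[OF that] by simp
  obtain T where T: "linear T" "\<And>x. norm (T x) \<le> norm x" "\<And>x. x \<in> E \<Longrightarrow> T x = J x"
    by (rule linf_extend_contraction[OF E J(1) norm_J]) (assumption, rule that)
  have ran: "range (blinfun_apply P) = J ` E" and idem: "blinfun_apply P (blinfun_apply P y) = blinfun_apply P y" for y
    using P by (auto simp: projections_onto_def J_def simp flip: blinfun_apply_blinfun_compose)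
  have P_id: "blinfun_apply P (J x) = J x" if "x \<in> E" for x
    using that idem ran by (metis imageI rangeE)
  define Q where "Q x = L (blinfun_apply P (T x))" for x
  have "linear Q"
    unfolding Q_def by (rule linearI) (simp_all add: linear_add[OF T(1)] linear_add[OF L(1)] linear_scale[OF T(1)]
        linear_scale[OF L(1)] blinfun.add_right blinfun.scaleR_right)
  moreover have "Q x \<in> E" for x by (simp add: Q_def L(2))
  moreover have "Q x = x" if "x \<in> E" for x using that by (simp add: Q_def T(3) P_id L(3))
  moreover have "norm (Q x) \<le> norm P * norm x" for x
  proof -
    obtain z where z: "z \<in> E" "blinfun_apply P (T x) = J z" using ran by blast
    have "norm (Q x) = norm (blinfun_apply P (T x))" using z J(2) L(3) by (simp add: Q_def)
    also have "\<dots> \<le> norm P * norm (T x)" by (rule norm_blinfun)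
    also have "\<dots> \<le> norm P * norm x" by (intro mult_left_mono T(2)) simp
    finally show ?thesis .
  qed
  ultimately show thesis by (rule that)
qed

text \<open>
  The type \<open>'n\<close> serves only as an index set for \<open>d\<close> coordinates, so that matrices and separating
  hyperplanes are available.
\<close>

lemma codim_two_projection:
  fixes E :: "linf set"
  assumes card: "CARD('n::finite) = d" and d: "6 \<le> d"
    and E: "subspace E" "E \<subseteq> linf_fin d" "dim E + 2 = d" and e: "0 < e"
  shows "\<exists>P\<in>projections_onto (fixed_embedding E ` E). norm P \<le> 7/3 - 4 / d + e"
proof -
  define c where "c = 7/3 - 4 / real d + e"
  have "4 / real d \<le> 1" using d by simp
  then have c: "0 \<le> c" using e by (simp add: c_def)
  obtain idx :: "'n \<Rightarrow> nat" where idx: "bij_betw idx UNIV {..<d}"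
    using ex_bij_betw_finite_nat[of "UNIV :: 'n set"] card by (auto simp: atLeast0LessThan)
  define ix where "ix = inv_into UNIV idx"
  have idx_lt: "idx s < d" for s using bij_betwE[OF idx] by auto
  have ix_idx: "ix (idx s) = s" for s
    unfolding ix_def by (rule inv_into_f_f) (use idx in \<open>auto simp: bij_betw_def\<close>)
  have idx_ix: "idx (ix i) = i" if "i < d" for i
    unfolding ix_def by (rule f_inv_into_f) (use idx that in \<open>auto simp: bij_betw_def\<close>)
  define dec :: "linf \<Rightarrow> real^'n" where "dec y = (\<chi> s. apply_bcontfun y (idx s))" for y
  define enc :: "real^'n \<Rightarrow> linf" where "enc v = Bcontfun (\<lambda>i. if i < d then v $ ix i else 0)" for v
  have enc: "apply_bcontfun (enc v) i = (if i < d then v $ ix i else 0)" for v i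
  proof -
    have "\<bar>if i < d then v $ ix i else 0\<bar> \<le> norm v" for i
      using component_le_norm_cart[of v "ix i"] by auto
    from apply_Bcontfun[OF this] show ?thesis by (simp add: enc_def)
  qed
  have lin_enc: "linear enc"
    by (intro linearI bcontfun_eqI) (auto simp: enc)
  have lin_dec: "linear dec"
    by (intro linearI) (auto simp: dec_def vec_eq_iff)
  have dec_enc: "dec (enc v) = v" for v
    by (simp add: dec_def enc idx_lt ix_idx vec_eq_iff)
  have enc_dec: "enc (dec y) = y" if "y \<in> linf_fin d" for y
    using that by (intro bcontfun_eqI) (auto simp: enc dec_def idx_ix linf_fin_def)
  define E' where "E' = dec ` E"
  have E_eq: "E = enc ` E'"
    using E(2) enc_dec by (force simp: E'_def image_image)
  have "dim (enc ` E') = dim E'"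
    by (rule dim_image_eq[OF lin_enc]) (metis dec_enc inj_onI)
  then have "dim E' + 2 = CARD('n)" using E_eq E(3) card by simp
  moreover have "subspace E'" unfolding E'_def by (rule linear_subspace_image[OF lin_dec E(1)])
  ultimately obtain A :: "real^'n^'n" where A: "\<And>y. A *v y \<in> E'" "\<And>y. y \<in> E' \<Longrightarrow> A *v y = y"
      "\<And>i. (\<Sum>j\<in>UNIV. \<bar>A $ i $ j\<bar>) \<le> c"
    using small_projection[of E' e] e d unfolding card c_def by metis
  define Q where "Q y = enc (A *v dec y)" for y
  have "linear Q"
    unfolding Q_def by (intro linearI)
      (simp_all add: linear_add[OF lin_dec] linear_add[OF lin_enc] linear_scale[OF lin_dec]
        linear_scale[OF lin_enc] matrix_vector_right_distrib matrix_vector_mult_scaleR)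
  moreover have "Q y \<in> E" for y using A(1) by (simp add: Q_def E_eq)
  moreover have "Q y = y" if "y \<in> E" for y
    using that E(2) A(2)[of "dec y"] enc_dec by (auto simp: Q_def E'_def)
  moreover have "norm (Q y) \<le> c * norm y" for y
  proof (rule norm_bound)
    fix i
    have "\<bar>(A *v dec y) $ s\<bar> \<le> c * norm y" for s
    proof -
      have "\<bar>(A *v dec y) $ s\<bar> \<le> (\<Sum>j\<in>UNIV. \<bar>A $ s $ j * dec y $ j\<bar>)"
        by (simp add: matrix_vector_mult_def sum_abs)
      also have "\<dots> \<le> (\<Sum>j\<in>UNIV. \<bar>A $ s $ j\<bar> * norm y)"
        using norm_bounded[of y] by (intro sum_mono) (auto simp: abs_mult dec_def intro!: mult_left_mono)
      also have "\<dots> = (\<Sum>j\<in>UNIV. \<bar>A $ s $ j\<bar>) * norm y" by (simp add: sum_distrib_right)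
      also have "\<dots> \<le> c * norm y" by (intro mult_right_mono A(3)) simp
      finally show ?thesis .
    qed
    then show "norm (apply_bcontfun (Q y) i) \<le> c * norm y"
      using c by (simp add: Q_def enc)
  qed
  ultimately show ?thesis
    using projection_transfer_to[OF E(1), of Q c] c unfolding c_def by blast
qed

section \<open>The extremal subspace\<close>

definition six_coords :: "real \<Rightarrow> real \<Rightarrow> real \<Rightarrow> real \<Rightarrow> real \<Rightarrow> real \<Rightarrow> linf" where
  "six_coords a b c d e f = Bcontfun (\<lambda>i. if i < 6 then [a, b, c, d, e, f] ! i else 0)"

lemma all_six_cases:
  fixes P :: "nat \<Rightarrow> bool"
  assumes "P 0" "P 1" "P 2" "P 3" "P 4" "P 5" "\<And>i. 6 \<le> i \<Longrightarrow> P i"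
  shows "P i"
proof (cases "i < 6")
  case True
  then have "i = 0 \<or> i = 1 \<or> i = 2 \<or> i = 3 \<or> i = 4 \<or> i = 5" by auto
  then show ?thesis using assms by auto
qed (use assms(7) in simp)

lemma apply_six_coords [simp]:
  "apply_bcontfun (six_coords a b c d e f) 0 = a" "apply_bcontfun (six_coords a b c d e f) (Suc 0) = b"
  "apply_bcontfun (six_coords a b c d e f) 2 = c" "apply_bcontfun (six_coords a b c d e f) 3 = d"
  "apply_bcontfun (six_coords a b c d e f) 4 = e" "apply_bcontfun (six_coords a b c d e f) 5 = f"
  "6 \<le> i \<Longrightarrow> apply_bcontfun (six_coords a b c d e f) i = 0"
proof -
  have "\<bar>if i < 6 then [a, b, c, d, e, f] ! i else 0\<bar> \<le> \<bar>a\<bar> + \<bar>b\<bar> + \<bar>c\<bar> + \<bar>d\<bar> + \<bar>e\<bar> + \<bar>f\<bar>" for i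
    by (rule all_six_cases) simp_all
  from apply_Bcontfun[OF this]
  show "apply_bcontfun (six_coords a b c d e f) 0 = a" "apply_bcontfun (six_coords a b c d e f) (Suc 0) = b"
    "apply_bcontfun (six_coords a b c d e f) 2 = c" "apply_bcontfun (six_coords a b c d e f) 3 = d"
    "apply_bcontfun (six_coords a b c d e f) 4 = e" "apply_bcontfun (six_coords a b c d e f) 5 = f"
    "6 \<le> i \<Longrightarrow> apply_bcontfun (six_coords a b c d e f) i = 0"
    by (simp_all add: six_coords_def)
qed

text \<open>
  Summing to zero against three planar unit vectors at mutual angles of 120 degrees, each of
  them used for two of the coordinates, means having equal pair sums.
\<close>

definition equal_pairs :: "linf set" where
  "equal_pairs = {y \<in> linf_fin 6.
     apply_bcontfun y 0 + apply_bcontfun y 1 = apply_bcontfun y 2 + apply_bcontfun y 3 \<and>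
      apply_bcontfun y 2 + apply_bcontfun y 3 = apply_bcontfun y 4 + apply_bcontfun y 5}"

lemma subspace_equal_pairs: "subspace equal_pairs"
  unfolding equal_pairs_def linf_fin_def
  by (auto simp: subspace_def simp flip: distrib_left)

lemma dim_equal_pairs: "dim equal_pairs = 4"
proof -
  define g :: "real^4 \<Rightarrow> linf" where
    "g v = six_coords (v $ 1) (v $ 4 - v $ 1) (v $ 2) (v $ 4 - v $ 2) (v $ 3) (v $ 4 - v $ 3)" for v
  have "linear g"
  proof (intro linearI bcontfun_eqI)
    show "apply_bcontfun (g (v + w)) i = apply_bcontfun (g v + g w) i" for v w i
      by (rule all_six_cases) (simp_all add: g_def)
    show "apply_bcontfun (g (t *\<^sub>R v)) i = apply_bcontfun (t *\<^sub>R g v) i" for t v i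
      by (rule all_six_cases) (simp_all add: g_def right_diff_distrib)
  qed
  have "inj g"
  proof (rule injI)
    fix v w assume "g v = g w"
    then have "apply_bcontfun (g v) i = apply_bcontfun (g w) i" for i by simp
    from this[of 0] this[of 2] this[of 4] this[of 1] have "v $ 1 = w $ 1" "v $ 2 = w $ 2" "v $ 3 = w $ 3" "v $ 4 = w $ 4"
      by (simp_all add: g_def)
    then show "v = w" by (simp add: vec_eq_iff forall_4)
  qed
  have "range g = equal_pairs"
  proof
    show "range g \<subseteq> equal_pairs" by (auto simp: equal_pairs_def linf_fin_def g_def)
    show "equal_pairs \<subseteq> range g"
    proof
      fix y assume y: "y \<in> equal_pairs"
      define v :: "real^4" where "v = (\<chi> i. if i = 1 then apply_bcontfun y 0 else if i = 2 then apply_bcontfun y 2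
        else if i = 3 then apply_bcontfun y 4 else apply_bcontfun y 0 + apply_bcontfun y 1)"
      have v: "v $ 1 = apply_bcontfun y 0" "v $ 2 = apply_bcontfun y 2" "v $ 3 = apply_bcontfun y 4"
        "v $ 4 = apply_bcontfun y 0 + apply_bcontfun y 1" by (simp_all add: v_def)
      have "y = g v"
      proof (rule bcontfun_eqI)
        show "apply_bcontfun y i = apply_bcontfun (g v) i" for i
          by (rule all_six_cases) (use y in \<open>simp_all add: g_def v equal_pairs_def linf_fin_def\<close>)
      qed
      then show "y \<in> range g" by blast
    qed
  qed
  moreover have "dim (g ` UNIV) = dim (UNIV :: (real^4) set)"
    by (rule dim_image_eq[OF \<open>linear g\<close>]) (use \<open>inj g\<close> in simp)
  ultimately show ?thesis by simp
qed

text \<open>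
  Let \<open>B\<close> be the symmetric matrix with entries 1, except for \<open>- 1\<close> between the two members of a pair.
  It maps \<open>equal_pairs\<close> into itself, with trace 10 there: the eigenvalue is 2 on the differences
  \<open>d k\<close> and 4 on the constants. As it also maps the orthogonal complement into itself, the trace of
  \<open>Q B\<close> is 10 for every projection \<open>Q\<close> onto \<open>equal_pairs\<close>. The six columns of \<open>B\<close> have norm 1, so each of
  the six diagonal entries of \<open>Q B\<close> is at most \<open>c\<close>.

  Explicitly, the columns that belong to the pair \<open>k\<close> are \<open>d k + (one - f k)\<close> and
  \<open>- d k + (one - f k)\<close>, where \<open>f k\<close> is the indicator of the pair. Since \<open>Q\<close> fixes \<open>d k\<close> and \<open>one\<close>, the two
  diagonal entries add up to 4 minus the sum of \<open>Q (f k)\<close> over the pair \<open>k\<close>. That sum may be taken over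
  any other pair instead, and the \<open>f k\<close> add up to \<open>one\<close>.
\<close>

lemma equal_pairs_lower_bound:
  assumes Q: "linear Q" "\<And>x. Q x \<in> equal_pairs" "\<And>x. x \<in> equal_pairs \<Longrightarrow> Q x = x"
    and norm_Q: "\<And>x. norm (Q x) \<le> c * norm x"
  shows "5 / 3 \<le> c"
proof -
  define one where "one = six_coords 1 1 1 1 1 1"
  define f where "f = (!) [six_coords 1 1 0 0 0 0, six_coords 0 0 1 1 0 0, six_coords 0 0 0 0 1 1]"
  define d where "d = (!) [six_coords 1 (-1) 0 0 0 0, six_coords 0 0 1 (-1) 0 0, six_coords 0 0 0 0 1 (-1)]"
  have less_3_cases: "k = 0 \<or> k = 1 \<or> k = 2" if "k < 3" for k :: nat using that by auto
  have one_in: "one \<in> equal_pairs"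
    by (simp add: equal_pairs_def linf_fin_def one_def)
  have d_in: "d k \<in> equal_pairs" if "k < 3" for k
    using less_3_cases[OF that] by (auto simp: equal_pairs_def linf_fin_def d_def)
  have sum_f: "f 0 + f 1 + f 2 = one"
  proof (rule bcontfun_eqI)
    show "apply_bcontfun (f 0 + f 1 + f 2) i = apply_bcontfun one i" for i
      by (rule all_six_cases) (simp_all add: f_def one_def)
  qed
  have c: "0 \<le> c"
  proof -
    have "one \<noteq> 0"
    proof
      assume "one = 0"
      then have "apply_bcontfun one 0 = 0" by simp
      then show False by (simp add: one_def)
    qed
    moreover have "norm one \<le> c * norm one" using norm_Q[of one] Q(3)[OF one_in] by simp
    ultimately show ?thesis by (simp add: mult_le_cancel_right1)
  qed
  have bound: "\<bar>apply_bcontfun (Q x) i\<bar> \<le> c" if "\<And>i. \<bar>apply_bcontfun x i\<bar> \<le> 1" for x i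
  proof -
    have "\<bar>apply_bcontfun (Q x) i\<bar> \<le> norm (Q x)" using norm_bounded[of "Q x" i] by simp
    also have "\<dots> \<le> c * norm x" by (rule norm_Q)
    also have "\<dots> \<le> c * 1" by (intro mult_left_mono c norm_bound) (use that in simp)
    finally show ?thesis by simp
  qed
  have plus: "2 - apply_bcontfun (Q (f k)) (2 * k) \<le> c" and minus: "2 - apply_bcontfun (Q (f k)) (2 * k + 1) \<le> c"
    if k: "k < 3" for k
  proof -
    have "Q (d k + (one - f k)) = d k + (one - Q (f k))" "Q (- d k + (one - f k)) = - d k + (one - Q (f k))"
      by (simp_all add: linear_add[OF Q(1)] linear_diff[OF Q(1)] linear_neg[OF Q(1)] Q(3) one_in d_in k)
    moreover have small: "\<bar>apply_bcontfun (d k + (one - f k)) i\<bar> \<le> 1 \<and> \<bar>apply_bcontfun (- d k + (one - f k)) i\<bar> \<le> 1" for i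
      by (rule all_six_cases[of _ i]) (use less_3_cases[OF k] in \<open>auto simp: f_def one_def d_def\<close>)
    have "\<bar>apply_bcontfun (Q (d k + (one - f k))) (2 * k)\<bar> \<le> c"
       "\<bar>apply_bcontfun (Q (- d k + (one - f k))) (2 * k + 1)\<bar> \<le> c"
      by (rule bound, use small in blast)+
    ultimately have "\<bar>apply_bcontfun (d k + (one - Q (f k))) (2 * k)\<bar> \<le> c"
       "\<bar>apply_bcontfun (- d k + (one - Q (f k))) (2 * k + 1)\<bar> \<le> c"
      by (simp_all only:)
    moreover have "apply_bcontfun (d k) (2 * k) = 1" "apply_bcontfun (d k) (2 * k + 1) = -1"
      "apply_bcontfun one (2 * k) = 1" "apply_bcontfun one (2 * k + 1) = 1"
      using less_3_cases[OF k] by (auto simp: d_def one_def)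
    ultimately show "2 - apply_bcontfun (Q (f k)) (2 * k) \<le> c" "2 - apply_bcontfun (Q (f k)) (2 * k + 1) \<le> c"
      by simp_all
  qed
  define pair_sum where "pair_sum k y = apply_bcontfun y (2 * k) + apply_bcontfun y (2 * k + 1)"
    for k :: nat and y :: linf
  have any_pair: "pair_sum k (Q x) = pair_sum 0 (Q x)" if "k < 3" for k x
    using less_3_cases[OF that] Q(2)[of x] by (auto simp: pair_sum_def equal_pairs_def)
  have "4 - pair_sum k (Q (f k)) \<le> 2 * c" if "k < 3" for k
    using plus[OF that] minus[OF that] by (simp add: pair_sum_def)
  then have "4 - pair_sum 0 (Q (f k)) \<le> 2 * c" if "k < 3" for k
    using any_pair[OF that, of "f k"] that by metis
  from this[of 0] this[of 1] this[of 2]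
  have "12 - (pair_sum 0 (Q (f 0)) + pair_sum 0 (Q (f 1)) + pair_sum 0 (Q (f 2))) \<le> 6 * c"
    by simp
  also have "pair_sum 0 (Q (f 0)) + pair_sum 0 (Q (f 1)) + pair_sum 0 (Q (f 2))
      = pair_sum 0 (Q (f 0) + Q (f 1) + Q (f 2))"
    by (simp add: pair_sum_def)
  also have "Q (f 0) + Q (f 1) + Q (f 2) = one"
    using sum_f Q(3)[OF one_in] by (simp flip: linear_add[OF Q(1)])
  also have "pair_sum 0 one = 2"
    by (simp add: pair_sum_def one_def)
  finally show ?thesis by simp
qed

section \<open>The maximal projection constant\<close>

theorem mainTheorem4:
  shows "max_proj_const 4 6 = 5 / 3"
proof -
  define \<E> where "\<E> = {E. subspace E \<and> E \<subseteq> linf_fin 6 \<and> dim E = 4}"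
  have ex: "\<exists>P\<in>projections_onto (fixed_embedding E ` E). norm P \<le> 5/3 + e" if "E \<in> \<E>" "0 < e" for E e
    using codim_two_projection[where 'n = 6, of 6 E e] that by (simp add: \<E>_def)
  have upper: "proj_const E \<le> 5 / 3" if "E \<in> \<E>" for E
  proof (rule field_le_epsilon)
    fix e :: real assume "0 < e"
    then obtain P where P: "P \<in> projections_onto (fixed_embedding E ` E)" "norm P \<le> 5/3 + e"
      using ex[OF \<open>E \<in> \<E>\<close>] by blast
    have "proj_const E \<le> norm P"
      unfolding proj_const_def by (rule cInf_lower) (use P in \<open>auto intro: bdd_belowI2[of _ 0]\<close>)
    with P(2) show "proj_const E \<le> 5/3 + e" by simp
  qed
  have mem: "equal_pairs \<in> \<E>"
    using subspace_equal_pairs dim_equal_pairs by (auto simp: \<E>_def equal_pairs_def)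
  have "5 / 3 \<le> proj_const equal_pairs"
    unfolding proj_const_def
  proof (rule cInf_greatest)
    show "norm ` projections_onto (fixed_embedding equal_pairs ` equal_pairs) \<noteq> {}"
      using ex[OF mem, of 1] by auto
  next
    fix c assume "c \<in> norm ` projections_onto (fixed_embedding equal_pairs ` equal_pairs)"
    then obtain P where P: "P \<in> projections_onto (fixed_embedding equal_pairs ` equal_pairs)" "c = norm P" by blast
    show "5 / 3 \<le> c"
      using projection_transfer_from[OF subspace_equal_pairs P(1)] equal_pairs_lower_bound P(2) by metis
  qed
  also have "\<dots> \<le> Sup (proj_const ` \<E>)"
    by (rule cSup_upper) (use mem upper in \<open>auto intro: bdd_aboveI2[of _ _ "5/3"]\<close>)
  finally have "5 / 3 \<le> max_proj_const 4 6" by (simp add: max_proj_const_def \<E>_def)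
  moreover have "max_proj_const 4 6 \<le> 5 / 3"
    unfolding max_proj_const_def \<E>_def[symmetric]
    by (rule cSup_least) (use mem upper in auto)
  ultimately show ?thesis by simp
qed

end
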